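(* Let $G=(V,E)$ be a graph and let $e=uv\in E$ be an edge. Then $$\gamma_{\rm esp}(G)-1\le \gamma_{\rm esp}(G-e)\le \gamma_{\rm esp}(G)+2.$$
   Context: Graphs are finite, simple and undirected. For a graph $G=(V,E)$ and $S\subseteq V$, write $\overline{S}=V\setminus S$, and let $N(v)$ be the open neighbourhood of $v$. A set $S \subseteq V$ is an end super dominating set (ESD-set) of $G$ if for every $u\in\overline{S}$ there exists $v\in S$ with $N(v)\cap\overline{S}=\{u\}$, and moreover $\deg(u)\ge 2$ for every $u\in\overline{S}$. The end super domination number $\gamma_{\rm esp}(G)$ is the minimum cardinality of an ESD-set of $G$. $G-e$ denotes the graph obtained from $G$ by removing the edge $e$ (keeping all vertices); it need not be connected. *)

theory Defs
  imports Main
begin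

text \<open>A finite simple undirected graph is given by its vertex set \<open>V\<close> and its edge set \<open>E\<close>, the
  edges being two-element subsets of \<open>V\<close>.\<close>

locale fin_simple_graph =
  fixes V :: "'a set" and E :: "'a set set"
  assumes finite_V: "finite V"
    and edges: "e \<in> E \<Longrightarrow> e \<subseteq> V \<and> card e = 2"

definition neighborhood :: "'a set set \<Rightarrow> 'a \<Rightarrow> 'a set" where
  "neighborhood E v = {w. {v, w} \<in> E}"

definition degree :: "'a set set \<Rightarrow> 'a \<Rightarrow> nat" where
  "degree E v = card (neighborhood E v)"

definition end_super_dominating :: "'a set \<Rightarrow> 'a set set \<Rightarrow> 'a set \<Rightarrow> bool" where
  "end_super_dominating V E S \<longleftrightarrow>
     S \<subseteq> V \<and>
     (\<forall>u\<in>V - S. (\<exists>v\<in>S. neighborhood E v \<inter> (V - S) = {u}) \<and> degree E u \<ge> 2)"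

text \<open>In a finite graph the minimum ranges over a finite set that contains \<open>card V\<close>, because
  \<open>V\<close> itself is an ESD-set.\<close>

definition end_super_domination_number :: "'a set \<Rightarrow> 'a set set \<Rightarrow> nat" where
  "end_super_domination_number V E = Min {card S | S. end_super_dominating V E S}"

end

theory Submission
  imports Defs
begin

text \<open>Let \<open>G\<close> and \<open>H\<close> differ only in the edge \<open>uv\<close>. Enlarging an ESD-set of \<open>G\<close> by \<open>u\<close> and \<open>v\<close>
  gives an ESD-set of \<open>H\<close>, since every remaining vertex outside it keeps its degree and its
  dominator; this is the upper bound. For the lower bound, an ESD-set of \<open>G - e\<close> that contains
  neither \<open>u\<close> nor \<open>v\<close> is already an ESD-set of \<open>G\<close>, and otherwise the enlargement adds at most
  one vertex.\<close>

lemma (in fin_simple_graph) finite_neighborhood: "finite (neighborhood E w)"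
proof (rule finite_subset[OF _ finite_V])
  show "neighborhood E w \<subseteq> V"
    using edges unfolding neighborhood_def by blast
qed

lemma end_super_dominating_self: "end_super_dominating V E V"
  by (simp add: end_super_dominating_def)

lemma finite_end_super_dominating_cards:
  assumes "finite V"
  shows "finite {card S | S. end_super_dominating V E S}"
proof (rule finite_subset)
  show "{card S | S. end_super_dominating V E S} \<subseteq> card ` Pow V"
    by (auto simp: end_super_dominating_def)
qed (use assms in simp)

lemma end_super_domination_number_le:
  assumes "finite V" "end_super_dominating V E S"
  shows "end_super_domination_number V E \<le> card S"
  unfolding end_super_domination_number_def
  using finite_end_super_dominating_cards[OF assms(1)] assms(2) by (intro Min_le) auto

lemma end_super_domination_number_attained:
  assumes "finite V"
  obtains S where "end_super_dominating V E S" "card S = end_super_domination_number V E"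
proof -
  have "end_super_domination_number V E \<in> {card S | S. end_super_dominating V E S}"
    unfolding end_super_domination_number_def
    using finite_end_super_dominating_cards[OF assms] end_super_dominating_self
    by (intro Min_in) auto
  then show ?thesis using that by auto
qed

text \<open>With both endpoints inside the set, the pair \<open>{u, v}\<close> is invisible to the
  condition on the vertices outside it. The hypothesis is symmetric in \<open>E\<close> and
  \<open>F\<close>, so the same lemma serves for deleting the edge and for putting it back.\<close>

lemma end_super_dominating_insert_endpoints:
  assumes S: "end_super_dominating V E S"
    and "u \<in> V" "v \<in> V"
    and EF: "E - {{u, v}} = F - {{u, v}}"
  shows "end_super_dominating V F (insert u (insert v S))"
  unfolding end_super_dominating_def
proof (intro conjI ballI)
  show "insert u (insert v S) \<subseteq> V"
    using assms by (auto simp: end_super_dominating_def)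
  \<comment> \<open>A pair containing a vertex other than \<open>u\<close> and \<open>v\<close>
    cannot be the altered one.\<close>
  have edge_iff: "{x, w} \<in> F \<longleftrightarrow> {x, w} \<in> E" if "w \<notin> {u, v}" for x w
    using EF that by (auto simp: doubleton_eq_iff)
  fix w assume w: "w \<in> V - insert u (insert v S)"
  then obtain x where x: "x \<in> S" "neighborhood E x \<inter> (V - S) = {w}" and "degree E w \<ge> 2"
    using S unfolding end_super_dominating_def by blast
  have "neighborhood F w = neighborhood E w"
    using w edge_iff[of w] by (auto simp: neighborhood_def insert_commute)
  with \<open>degree E w \<ge> 2\<close> show "degree F w \<ge> 2"
    by (simp add: degree_def)
  \<comment> \<open>The dominator \<open>x\<close> may itself be \<open>u\<close> or
    \<open>v\<close>. Even then it gains or loses only \<open>u\<close> or \<open>v\<close> as a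
    neighbour, and both lie in the enlarged set; \<open>w\<close> stays outside that set.\<close>
  have "neighborhood F x \<inter> (V - insert u (insert v S)) = {w}"
    using x w edge_iff by (auto simp: neighborhood_def)
  with x show "\<exists>x\<in>insert u (insert v S).
      neighborhood F x \<inter> (V - insert u (insert v S)) = {w}"
    by blast
qed

text \<open>The new edge joins two vertices of the complement, so no dominator, being in
  \<open>S\<close>, sees it, while degrees can only grow.\<close>

lemma end_super_dominating_add_edge:
  assumes "fin_simple_graph V (insert {u, v} E)"
    and S: "end_super_dominating V E S"
    and uv: "u \<notin> S" "v \<notin> S"
  shows "end_super_dominating V (insert {u, v} E) S"
  unfolding end_super_dominating_def
proof (intro conjI ballI)
  show "S \<subseteq> V"
    using S by (simp add: end_super_dominating_def)
  fix w assume w: "w \<in> V - S"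
  then obtain x where x: "x \<in> S" "neighborhood E x \<inter> (V - S) = {w}" and "degree E w \<ge> 2"
    using S unfolding end_super_dominating_def by blast
  have "degree E w \<le> degree (insert {u, v} E) w"
    unfolding degree_def
    \<comment> \<open>Finiteness matters here: an infinite neighbourhood would have
      \<open>card\<close> equal to 0.\<close>
    by (rule card_mono[OF fin_simple_graph.finite_neighborhood[OF assms(1)]])
      (auto simp: neighborhood_def)
  with \<open>degree E w \<ge> 2\<close> show "degree (insert {u, v} E) w \<ge> 2"
    by simp
  have "neighborhood (insert {u, v} E) x = neighborhood E x"
    using x uv by (auto simp: neighborhood_def doubleton_eq_iff)
  with x show "\<exists>x\<in>S. neighborhood (insert {u, v} E) x \<inter> (V - S) = {w}"
    by auto
qed

theorem theorem6p1:
  fixes V :: "'a set" and E :: "'a set set" and u v :: 'a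
  assumes "fin_simple_graph V E"
    and "{u, v} \<in> E"
  shows "int (end_super_domination_number V E) - 1
           \<le> int (end_super_domination_number V (E - {{u, v}}))
       \<and> int (end_super_domination_number V (E - {{u, v}}))
           \<le> int (end_super_domination_number V E) + 2"
proof -
  interpret fin_simple_graph V E by fact
  let ?F = "E - {{u, v}}"
  have V: "u \<in> V" "v \<in> V"
    using edges[OF assms(2)] by auto
  have E: "insert {u, v} ?F = E"
    using assms(2) by auto
  have "end_super_domination_number V E \<le> end_super_domination_number V ?F + 1"
  proof -
    obtain S where S: "end_super_dominating V ?F S"
      "card S = end_super_domination_number V ?F"
      using end_super_domination_number_attained[OF finite_V] .
    have "finite S"
      using S finite_V by (auto simp: end_super_dominating_def intro: finite_subset)
    show ?thesis
    \<comment> \<open>Enlarging \<open>S\<close> by both endpoints costs two vertices exactly when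
      neither is in \<open>S\<close>, and in that case \<open>S\<close> itself already
      works.\<close>
    proof (cases "u \<notin> S \<and> v \<notin> S")
      case True
      then have "end_super_dominating V E S"
        using end_super_dominating_add_edge[of V u v ?F S] S assms(1) E by simp
      then show ?thesis
        using end_super_domination_number_le[OF finite_V] S(2) by fastforce
    next
      case False
      have "end_super_dominating V E (insert u (insert v S))"
        by (rule end_super_dominating_insert_endpoints[OF S(1) V]) simp
      moreover have "card (insert u (insert v S)) \<le> card S + 1"
        using False \<open>finite S\<close> by (auto simp: card_insert_if)
      ultimately show ?thesis
        using end_super_domination_number_le[OF finite_V] S(2) by fastforce
    qed
  qed
  moreover have "end_super_domination_number V ?F \<le> end_super_domination_number V E + 2"
  proof -
    obtain S where S: "end_super_dominating V E S" "card S = end_super_domination_number V E"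
      using end_super_domination_number_attained[OF finite_V] .
    have "finite S"
      using S finite_V by (auto simp: end_super_dominating_def intro: finite_subset)
    have "end_super_dominating V ?F (insert u (insert v S))"
      by (rule end_super_dominating_insert_endpoints[OF S(1) V]) simp
    moreover have "card (insert u (insert v S)) \<le> card S + 2"
      using \<open>finite S\<close> by (auto simp: card_insert_if)
    ultimately show ?thesis
      using end_super_domination_number_le[OF finite_V] S(2) by fastforce
  qed
  ultimately show ?thesis
    by linarith
qed

end
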